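(* Let $p$ be an odd prime and $n\ge 4$ an even integer whose base-$p$ digit sum $w_p(n)$ is not equal to $2$. Let $$f_{n,0}(x)=2\sum_{j\geq 0}\binom{n}{2j}x^j\in\mathbb{F}_p[x],\qquad C_n(x):=f_{n,0}(x)-2x^{n/2}.$$ Then, with $N=n/2$, $C_n(x)$ viewed as an element of $\mathbb{F}_p[x]/(x^N-1)$ is a coterm polynomial.
   Context: Coefficients are reduced modulo $p$; binomial coefficients $\binom{a}{b}$ are $0$ when $b>a$. $w_p(n)$ denotes the sum of the digits of $n$ in base $p$. For a commutative ring $R$ with identity and $N\ge1$, a polynomial $a_0+a_1x+\cdots+a_{N-1}x^{N-1}\in R[x]/(x^N-1)$ is a coterm polynomial if $a_i=a_{N-i}$ for all $1\le i\le\lfloor N/2\rfloor$. *)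

theory Defs
  imports "Berlekamp_Zassenhaus.Finite_Field" "HOL-Computational_Algebra.Polynomial"
begin

function digit_sum :: "nat \<Rightarrow> nat \<Rightarrow> nat" where
  "digit_sum p n = (if p < 2 \<or> n = 0 then 0 else n mod p + digit_sum p (n div p))"
  by pat_completeness auto
termination
  by (relation "measure snd") auto

declare digit_sum.simps [simp del]

text \<open>
  For a commutative ring \<open>R\<close>, the quotient \<open>R[x]/(x\<^sup>N - 1)\<close> is modelled as the set
  \<open>UNIV // cyclic_rel N\<close> of residue classes of polynomials modulo \<open>x\<^sup>N - 1\<close>;
  \<open>cyclic_class N\<close> is the canonical projection from \<open>R[x]\<close> onto it.
\<close>

definition cyclic_rel :: "nat \<Rightarrow> ('a :: comm_ring_1 poly \<times> 'a poly) set" where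
  "cyclic_rel N = {(f, g). monom 1 N - 1 dvd f - g}"

definition cyclic_class :: "nat \<Rightarrow> 'a :: comm_ring_1 poly \<Rightarrow> 'a poly set" where
  "cyclic_class N f = cyclic_rel N `` {f}"

definition coterm :: "nat \<Rightarrow> 'a :: comm_ring_1 poly set \<Rightarrow> bool" where
  "coterm N A \<longleftrightarrow> N \<ge> 1 \<and>
     (\<exists>a. A = cyclic_class N (\<Sum>i<N. monom (a i) i) \<and>
          (\<forall>i\<in>{1..N div 2}. a i = a (N - i)))"

lemma equiv_cyclic_rel: "equiv UNIV (cyclic_rel N :: ('a :: comm_ring_1 poly \<times> 'a poly) set)"
proof (rule equivI)
  show "sym (cyclic_rel N :: ('a poly \<times> 'a poly) set)"
  proof (rule symI)
    fix f g :: "'a poly"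
    assume "(f, g) \<in> cyclic_rel N"
    then have "monom 1 N - 1 dvd - (f - g)"
      by (simp only: cyclic_rel_def mem_Collect_eq split_conv dvd_minus_iff)
    then show "(g, f) \<in> cyclic_rel N" by (simp add: cyclic_rel_def)
  qed
  show "trans (cyclic_rel N :: ('a poly \<times> 'a poly) set)"
  proof (rule transI)
    fix f g h :: "'a poly"
    assume "(f, g) \<in> cyclic_rel N" "(g, h) \<in> cyclic_rel N"
    then show "(f, h) \<in> cyclic_rel N"
      using dvd_add[of "monom 1 N - 1" "f - g" "g - h"] by (simp add: cyclic_rel_def)
  qed
qed (auto simp: refl_on_def cyclic_rel_def)

lemma cyclic_class_eq_iff: "cyclic_class N f = cyclic_class N g \<longleftrightarrow> monom 1 N - 1 dvd f - g"
  using eq_equiv_class_iff[OF equiv_cyclic_rel, of f g N]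
  by (simp add: cyclic_class_def cyclic_rel_def)

text \<open>
  The representative of degree less than \<open>N\<close> is unique, so the coefficients in the definition
  of \<open>coterm\<close> are determined by the residue class.
\<close>

lemma cyclic_class_inj:
  fixes f g :: "'a :: comm_ring_1 poly"
  assumes "degree f < N" "degree g < N"
  shows "cyclic_class N f = cyclic_class N g \<longleftrightarrow> f = g"
proof
  assume "cyclic_class N f = cyclic_class N g"
  then obtain q where q: "f - g = (monom 1 N - 1) * q"
    unfolding cyclic_class_eq_iff by (auto elim: dvdE)
  have N: "N > 0" using assms by simp
  have deg: "degree (monom 1 N - 1 :: 'a poly) = N"
    using N by (intro antisym degree_diff_le le_degree) (auto simp: degree_monom_le)
  have "coeff (f - g) (N + degree q) = coeff q (degree q)"
    using coeff_mult_degree_sum[of "monom 1 N - 1" q] N by (simp add: q deg)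
  moreover have "coeff (f - g) (N + degree q) = 0"
    using assms by (simp add: coeff_eq_0)
  ultimately have "q = 0" by simp
  then show "f = g" using q by simp
qed simp

lemma coterm_cyclic_class_iff:
  fixes f :: "'a :: comm_ring_1 poly"
  assumes "degree f < N"
  shows "coterm N (cyclic_class N f) \<longleftrightarrow> (\<forall>i\<in>{1..N div 2}. coeff f i = coeff f (N - i))"
proof -
  have c: "coeff (\<Sum>i<N. monom (a i) i) k = (if k < N then a k else 0)" for a :: "nat \<Rightarrow> 'a" and k
    by (simp add: coeff_sum)
  have deg: "degree (\<Sum>i<N. monom (a i) i) < N" for a :: "nat \<Rightarrow> 'a"
    using assms by (intro le_less_trans[OF degree_le[of "N - 1"]]) (auto simp: c)
  have self: "f = (\<Sum>i<N. monom (coeff f i) i)"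
    using assms by (intro poly_eqI) (simp add: c coeff_eq_0)
  show ?thesis
  proof
    assume "coterm N (cyclic_class N f)"
    then obtain a where a: "f = (\<Sum>i<N. monom (a i) i)" "\<forall>i\<in>{1..N div 2}. a i = a (N - i)"
      unfolding coterm_def cyclic_class_inj[OF assms deg] by (elim conjE exE)
    show "\<forall>i\<in>{1..N div 2}. coeff f i = coeff f (N - i)"
    proof
      fix i assume i: "i \<in> {1..N div 2}"
      have "coeff f k = a k" if "k < N" for k
        using that by (subst a(1)) (simp only: c if_True)
      moreover have "i < N" "N - i < N" using i by auto
      ultimately show "coeff f i = coeff f (N - i)" using a(2) i by metis
    qed
  next
    assume "\<forall>i\<in>{1..N div 2}. coeff f i = coeff f (N - i)"
    moreover have "N \<ge> 1" using assms by simp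
    ultimately show "coterm N (cyclic_class N f)"
      unfolding coterm_def cyclic_class_inj[OF assms deg]
      by (intro conjI exI[of _ "coeff f"] self)
  qed
qed

text \<open>
  The sum over all \<open>j \<ge> 0\<close> stops at \<open>n div 2\<close>, since \<open>n choose (2 * j) = 0\<close> for larger \<open>j\<close>.
\<close>

definition f_n0 :: "nat \<Rightarrow> 'a :: comm_ring_1 poly" where
  "f_n0 n = 2 * (\<Sum>j\<le>n div 2. monom (of_nat (n choose (2 * j))) j)"

definition C_poly :: "nat \<Rightarrow> 'a :: comm_ring_1 poly" where
  "C_poly n = f_n0 n - 2 * monom 1 (n div 2)"

end

(* The term -2 x^(n/2) cancels the leading term of f_n0, so C_n is already the reduced
   representative modulo x^N - 1; its coefficients 2 (n choose 2i) are symmetric under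
   i -> N - i because n = 2N. *)
theory Submission
  imports Defs
begin

lemma coeff_C_poly:
  "coeff (C_poly n :: 'a :: comm_ring_1 poly) k =
     2 * (if k \<le> n div 2 then of_nat (n choose (2 * k)) else 0) - (if k = n div 2 then 2 else 0)"
proof -
  \<comment> \<open>The factor \<open>2\<close> is a numeral of the polynomial ring; reading it as
    \<open>f + f\<close> moves it to the coefficients.\<close>
  have two: "coeff (2 * f) j = 2 * coeff f j" for f :: "'a poly" and j
    by (simp only: mult_2 coeff_add)
  have sum: "coeff (\<Sum>j\<le>n div 2. monom (of_nat (n choose (2 * j)) :: 'a) j) k =
      (if k \<le> n div 2 then of_nat (n choose (2 * k)) else 0)"
    by (simp only: coeff_sum coeff_monom sum.delta' sum.delta finite_atMost atMost_iff)
  show ?thesis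
    unfolding C_poly_def f_n0_def coeff_diff two sum coeff_monom by auto
qed

lemma degree_C_poly_less:
  assumes "even n" and "n > 0"
  shows "degree (C_poly n :: 'a :: comm_ring_1 poly) < n div 2"
proof -
  \<comment> \<open>At index \<open>n div 2\<close> evenness gives 2 * (n choose n) - 2 = 0.
    Positivity of \<open>n\<close> keeps \<open>n div 2 - 1\<close> from truncating.\<close>
  have "degree (C_poly n :: 'a poly) \<le> n div 2 - 1"
    using assms by (intro degree_le) (auto simp: coeff_C_poly)
  moreover have "n div 2 > 0"
    using assms by auto
  ultimately show ?thesis by linarith
qed

lemma coterm_C_poly:
  assumes "even n" and "n > 0"
  shows "coterm (n div 2) (cyclic_class (n div 2) (C_poly n :: 'a :: comm_ring_1 poly))"
  unfolding coterm_cyclic_class_iff[OF degree_C_poly_less[OF assms]]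
proof
  fix i assume i: "i \<in> {1..n div 2 div 2}"
  have "2 * (n div 2 - i) = n - 2 * i"
    using \<open>even n\<close> by auto
  moreover have "n choose (2 * i) = n choose (n - 2 * i)"
    using i by (intro binomial_symmetric) auto
  \<comment> \<open>With N = \<open>n div 2\<close>, the bounds 1 \<le> i \<le> N/2 put both i and N
    - i strictly below N, so the correction at index N affects neither coefficient.\<close>
  ultimately show "coeff (C_poly n :: 'a poly) i = coeff (C_poly n) (n div 2 - i)"
    using i by (auto simp: coeff_C_poly)
qed

theorem theorem5p7:
  fixes p n N :: nat
  assumes "prime p" and "odd p" and "CARD('p :: prime_card) = p"
    and "n \<ge> 4" and "even n" and "digit_sum p n \<noteq> 2"
    and "N = n div 2"
  shows "coterm N (cyclic_class N (C_poly n :: 'p mod_ring poly))"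
  using assms by (auto intro: coterm_C_poly)

end
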